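(* The four-dimensional dual-cube $F_4$ admits two completely independent spanning trees. Consequently, for every integer $n\ge 1$, the $n$-dimensional dual-cube $F_n$ admits two completely independent spanning trees if and only if $n\ge 4$.
   Context: All graphs are simple and undirected. Dual-cube: for an integer $n\ge 1$, the dual-cube $F_n$ is the graph with vertex set $\{0,1\}^{2n-1}$, whose elements are written $u=(u_{2n-1},\dots,u_1)$, in which two vertices $u=(u_{2n-1},\dots,u_1)$ and $v=(v_{2n-1},\dots,v_1)$ are adjacent if and only if they differ in exactly one bit position $i\in\{1,\dots,2n-1\}$ and the following hold: (1) if $1\le i\le n-1$ then $u_{2n-1}=v_{2n-1}=0$; (2) if $n\le i\le 2n-2$ then $u_{2n-1}=v_{2n-1}=1$; (3) the position $i=2n-1$ is always allowed. In particular $F_4$ has vertex set $\{0,1\}^7$. Spanning trees: a spanning tree $T$ of a graph $G$ is a connected acyclic subgraph with $V(T)=V(G)$. Two $(x,y)$-paths $P_1,P_2$ are openly disjoint if they are edge-disjoint and share no vertex other than $x$ and $y$. Spanning trees $T_1,\dots,T_k$ of $G$ are completely independent if for every pair of distinct vertices $x,y$ of $G$, the $(x,y)$-paths in $T_1,\dots,T_k$ are pairwise openly disjoint. "$G$ admits two completely independent spanning trees" means that there exist spanning trees $T_1,T_2$ of $G$ that are completely independent. *)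

theory Defs
  imports "Graph_Theory.Digraph_Component"
begin

text \<open>
  A finite simple undirected graph is a \<^locale>\<open>pair_graph\<close>: a finite, loop-free, symmetric
  pair digraph in which the edge between u and v is the pair of arcs (u,v), (v,u).
\<close>

text \<open>
  The library predicates \<^const>\<open>forest\<close> and \<^const>\<open>tree\<close> regard (u,v), (v,u) as a
  cycle, so no symmetric graph with an edge satisfies them. The cycles of an undirected simple
  graph are the library cycles of length at least 3.
\<close>

definition undirected_acyclic :: "'a pair_pre_digraph \<Rightarrow> bool" where
  "undirected_acyclic T \<longleftrightarrow> \<not> (\<exists>p. pre_digraph.cycle (with_proj T) p \<and> 3 \<le> length p)"

definition undirected_spanning_tree :: "'a pair_pre_digraph \<Rightarrow> 'a pair_pre_digraph \<Rightarrow> bool" where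
  "undirected_spanning_tree T G \<longleftrightarrow>
     pair_graph T \<and> spanning (with_proj T) (with_proj G) \<and>
     Digraph_Component.connected (with_proj T) \<and> undirected_acyclic T"

definition path_edges :: "('a \<times> 'a) awalk \<Rightarrow> 'a set set" where
  "path_edges p = (\<lambda>(u, v). {u, v}) ` set p"

definition openly_disjoint ::
    "'a \<Rightarrow> 'a \<Rightarrow> ('a \<times> 'a) awalk \<Rightarrow> ('a \<times> 'a) awalk \<Rightarrow> bool" where
  "openly_disjoint x y p q \<longleftrightarrow>
     path_edges p \<inter> path_edges q = {} \<and>
     set (pawalk_verts x p) \<inter> set (pawalk_verts x q) \<subseteq> {x, y}"

definition completely_independent_spanning_trees ::
    "'a pair_pre_digraph \<Rightarrow> 'a pair_pre_digraph list \<Rightarrow> bool" where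
  "completely_independent_spanning_trees G Ts \<longleftrightarrow>
     (\<forall>T \<in> set Ts. undirected_spanning_tree T G) \<and>
     (\<forall>x \<in> pverts G. \<forall>y \<in> pverts G. x \<noteq> y \<longrightarrow>
        (\<forall>i < length Ts. \<forall>j < length Ts. i \<noteq> j \<longrightarrow>
           (\<forall>p q. pre_digraph.apath (with_proj (Ts ! i)) x p y \<longrightarrow>
                  pre_digraph.apath (with_proj (Ts ! j)) x q y \<longrightarrow>
                  openly_disjoint x y p q)))"

definition admits_two_CISTs :: "'a pair_pre_digraph \<Rightarrow> bool" where
  "admits_two_CISTs G \<longleftrightarrow> (\<exists>T1 T2. completely_independent_spanning_trees G [T1, T2])"

text \<open>
  A bit string (u_m, ..., u_1) is the list [u_m, ..., u_1] of truth values (True for 1), so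
  positions are counted from 1 at the right end.
\<close>

definition bit_at :: "bool list \<Rightarrow> nat \<Rightarrow> bool" where
  "bit_at u i = u ! (length u - i)"

definition dual_cube_adj :: "nat \<Rightarrow> bool list \<Rightarrow> bool list \<Rightarrow> bool" where
  "dual_cube_adj n u v \<longleftrightarrow>
     (\<exists>i \<in> {1..2*n-1}.
        {j \<in> {1..2*n-1}. bit_at u j \<noteq> bit_at v j} = {i} \<and>
        (1 \<le> i \<and> i \<le> n-1 \<longrightarrow> \<not> bit_at u (2*n-1) \<and> \<not> bit_at v (2*n-1)) \<and>
        (n \<le> i \<and> i \<le> 2*n-2 \<longrightarrow> bit_at u (2*n-1) \<and> bit_at v (2*n-1)))"

definition dual_cube :: "nat \<Rightarrow> bool list pair_pre_digraph" where
  "dual_cube n =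
     \<lparr> pverts = {u. length u = 2*n-1},
       parcs = {(u, v). length u = 2*n-1 \<and> length v = 2*n-1 \<and> dual_cube_adj n u v} \<rparr>"

lemma dual_cube_adj_sym: "dual_cube_adj n u v \<Longrightarrow> dual_cube_adj n v u"
proof -
  have "{j \<in> {1..2*n-1}. bit_at u j \<noteq> bit_at v j} = {j \<in> {1..2*n-1}. bit_at v j \<noteq> bit_at u j}"
    by blast
  then show "dual_cube_adj n u v \<Longrightarrow> dual_cube_adj n v u"
    unfolding dual_cube_adj_def by metis
qed

lemma dual_cube_adj_irrefl: "\<not> dual_cube_adj n u u"
  unfolding dual_cube_adj_def by simp

lemma pair_graph_dual_cube: "pair_graph (dual_cube n)"
proof
  have "finite {u :: bool list. length u = 2*n-1}"
    using finite_lists_length_eq[of "UNIV :: bool set" "2*n-1"] by simp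
  then show fin: "finite (pverts (dual_cube n))"
    by (simp add: dual_cube_def)
  have "parcs (dual_cube n) \<subseteq> pverts (dual_cube n) \<times> pverts (dual_cube n)"
    by (auto simp: dual_cube_def)
  then show "finite (parcs (dual_cube n))"
    using fin by (meson finite_SigmaI finite_subset)
  have "sym (parcs (dual_cube n))"
    by (rule symI) (simp add: dual_cube_def dual_cube_adj_sym)
  then show "symmetric (with_proj (dual_cube n))"
    by (simp add: symmetric_def)
  show "fst e \<in> pverts (dual_cube n)" if "e \<in> parcs (dual_cube n)" for e
    using that by (cases e) (simp add: dual_cube_def)
  show "snd e \<in> pverts (dual_cube n)" if "e \<in> parcs (dual_cube n)" for e
    using that by (cases e) (simp add: dual_cube_def)
  show "fst e \<noteq> snd e" if "e \<in> parcs (dual_cube n)" for e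
    using that dual_cube_adj_irrefl by (cases e) (auto simp only: dual_cube_def
        mem_Collect_eq split_conv fst_conv snd_conv pair_pre_digraph.simps)
qed

end

theory Submission
  imports Defs
begin

text \<open>
  Two completely independent spanning trees of a graph can be read off a two-colouring of its
  vertices. Suppose that each colour class induces a connected subgraph, and that every vertex v
  has a partner f v, a neighbour of the other colour, with f (f v) different from v. Take a
  spanning tree of the subgraph induced by one colour and hang each vertex v of the other colour
  onto it as a leaf through the edge {v, f v}. The inner vertices of the two trees so obtained have
  different colours, so paths with the same ends share no inner vertex; and the trees share no
  edge, since an edge {v, f v} = {w, f w} with v and w of different colours would force
  f (f v) = v. This is \<open>CIST_partition_imp_two_CISTs\<close>; the partner function says that
  the bipartite graph between the two colours has no tree component.

  For \<open>n = 4\<close> the colouring, spanning trees of the two classes and the partners are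
  given by tables (\<open>CIST_partition_4\<close>). There is little room: the two trees use 254 of the
  256 edges.

  The colouring extends from \<open>n\<close> to \<open>n + 1\<close> (\<open>CIST_partition_extends\<close>). A vertex of the
  larger cube has one more low bit and one more high bit, and fixing both leaves a copy of the
  smaller cube. Colour and match every copy alike. Partners stay within a copy, so only the
  connectedness of the classes is at stake: vertices with top bit 0 are joined to the copy with
  the other low bit, vertices with top bit 1 to the copy with the other high bit, and both kinds
  of edge preserve colours. Hence each colour has to occur with both values of the top bit, which
  is carried along in the induction (\<open>meets_both_classes\<close>).

  For \<open>n \<le> 3\<close> there are too few edges. Independent spanning trees are edge-disjoint, so they need
  \<open>2 * (2 ^ (2*n-1) - 1)\<close> edges, whereas the cube is regular of degree \<open>n\<close> and has only
  \<open>n * 2 ^ (2*n-2)\<close> (\<open>two_CISTs_imp_ge_4\<close>).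
\<close>

section \<open>Spanning trees from parent functions\<close>

text \<open>
  Breadth-first search: d v is the distance from v to r, and p v is the first step of a shortest
  walk to r.
\<close>

lemma parent_function_exists:
  assumes "\<And>v. v \<in> A \<Longrightarrow> (v, r) \<in> R\<^sup>*"
  obtains p and d :: "'a \<Rightarrow> nat"
  where "\<And>v. v \<in> A \<Longrightarrow> v \<noteq> r \<Longrightarrow> (v, p v) \<in> R \<and> d (p v) < d v"
proof -
  define d where "d v = (LEAST k. (v, r) \<in> R ^^ k)" for v
  have "\<exists>w. (v, w) \<in> R \<and> d w < d v" if v: "v \<in> A" "v \<noteq> r" for v
  proof -
    have "\<exists>k. (v, r) \<in> R ^^ k"
      using assms[OF v(1)] by (simp add: rtrancl_power)
    then have walk: "(v, r) \<in> R ^^ d v"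
      unfolding d_def by (rule LeastI_ex)
    with v(2) obtain k where k: "d v = Suc k"
      by (cases "d v") auto
    with walk obtain w where w: "(v, w) \<in> R" "(w, r) \<in> R ^^ k"
      by (metis relpow_Suc_D2)
    then have "d w \<le> k"
      unfolding d_def by (intro Least_le)
    with w k show ?thesis by auto
  qed
  then have "\<exists>p. \<forall>v \<in> A. v \<noteq> r \<longrightarrow> (v, p v) \<in> R \<and> d (p v) < d v"
    by metis
  with that show thesis by blast
qed

definition parent_tree :: "'a set \<Rightarrow> 'a \<Rightarrow> ('a \<Rightarrow> 'a) \<Rightarrow> 'a pair_pre_digraph" where
  "parent_tree V r q =
     \<lparr> pverts = V, parcs = {(v, w). v \<in> V \<and> w \<in> V \<and> (v \<noteq> r \<and> w = q v \<or> w \<noteq> r \<and> v = q w)} \<rparr>"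

lemma parcs_parent_tree:
  "(v, w) \<in> parcs (parent_tree V r q) \<longleftrightarrow>
     v \<in> V \<and> w \<in> V \<and> (v \<noteq> r \<and> w = q v \<or> w \<noteq> r \<and> v = q w)"
  by (simp add: parent_tree_def)

lemma pverts_parent_tree [simp]: "pverts (parent_tree V r q) = V"
  by (simp add: parent_tree_def)

lemma pair_graph_symD:
  assumes "pair_graph G" "(u, v) \<in> parcs G"
  shows "(v, u) \<in> parcs G"
  using assms pair_sym_digraph.pair_sym_arcs[of G]
  by (auto simp: pair_graph_def pair_pseudo_graph_def symmetric_def elim: symE)

lemma pair_graph_spanning_subgraph:
  assumes G: "pair_graph G" and V: "pverts T = pverts G" and sub: "parcs T \<subseteq> parcs G"
    and "sym (parcs T)"
  shows "pair_graph T" "spanning (with_proj T) (with_proj G)"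
proof -
  interpret G: pair_graph G by (rule G)
  show T: "pair_graph T"
  proof
    show "finite (pverts T)"
      using V G.pair_finite_verts by simp
    show "finite (parcs T)"
      using sub G.pair_finite_arcs by (rule finite_subset)
    show "symmetric (with_proj T)"
      using assms(4) by (simp add: symmetric_def)
  qed (use sub V G.wellformed' G.pair_no_loops in auto)
  interpret T: pair_graph T by (rule T)
  show "spanning (with_proj T) (with_proj G)"
    using V sub G.wf_digraph T.wf_digraph
    by (auto simp: spanning_def subgraph_def compatible_def)
qed

lemma pcas_nth:
  assumes "pcas u p w" "Suc i < length p"
  shows "snd (p ! i) = fst (p ! Suc i)"
  using assms
proof (induction p arbitrary: u i)
  case (Cons e es)
  then show ?case
    by (cases i; cases es) auto
qed simp

lemma pcas_ends:
  assumes "pcas u p w" "p \<noteq> []"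
  shows "fst (p ! 0) = u" "snd (p ! (length p - 1)) = w"
proof -
  show "fst (p ! 0) = u" using assms by (cases p) auto
  show "snd (p ! (length p - 1)) = w" using assms
    by (induction u p w rule: pcas.induct) (auto simp: nth_Cons' split: if_splits)
qed

lemma pawalk_verts_tl: "pcas u p w \<Longrightarrow> tl (pawalk_verts u p) = map snd p"
proof (induction p arbitrary: u)
  case (Cons e es)
  show ?case using Cons.prems Cons.IH[of "snd e"]
    by (cases es) auto
qed simp

text \<open>
  The predecessor and the successor of a vertex on a closed walk without repetitions are different
  as soon as the walk has length at least 3. Walks are lists of arcs, so the vertices are addressed
  as heads of arcs, and the predecessor of the first one is found at the end of the list.
\<close>

lemma closed_walk_neighbours:
  assumes cas: "pcas u p u" and j: "j < length p" and len: "3 \<le> length p"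
    and dist: "distinct (map snd p)"
  obtains a b where "(a, snd (p ! j)) \<in> set p" "(snd (p ! j), b) \<in> set p"
    "a \<in> snd ` set p" "b \<in> snd ` set p" "a \<noteq> b"
proof -
  define i where "i = (if j = 0 then length p - 1 else j - 1)"
  define k where "k = (if Suc j = length p then 0 else Suc j)"
  have bounds: "i < length p" "k < length p" "i \<noteq> k"
    using j len by (auto simp: i_def k_def)
  have "p \<noteq> []" using len by auto
  note ends' = pcas_ends[OF cas this]
  have ends: "fst (p ! 0) = u" "Suc i = length p \<Longrightarrow> snd (p ! i) = u" for i
    using ends' by (simp, metis diff_Suc_1)
  have pred: "snd (p ! i) = fst (p ! j)"
    using ends' pcas_nth[OF cas, of "j - 1"] j by (auto simp: i_def)
  have succ: "snd (p ! j) = fst (p ! k)"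
    using ends pcas_nth[OF cas, of j] j by (cases "Suc j = length p") (auto simp: k_def)
  have "snd (p ! i) \<noteq> snd (p ! k)"
    using dist bounds by (auto simp: distinct_conv_nth)
  moreover have "p ! j = (snd (p ! i), snd (p ! j))" "p ! k = (snd (p ! j), snd (p ! k))"
    using pred succ by (simp_all add: prod_eq_iff)
  then have "(snd (p ! i), snd (p ! j)) \<in> set p" "(snd (p ! j), snd (p ! k)) \<in> set p"
    using nth_mem[OF j] nth_mem[OF bounds(2)] by metis+
  ultimately show thesis
    using that bounds by (meson image_eqI nth_mem)
qed

text \<open>
  On a cycle, let v be a vertex of greatest depth d. A neighbour of v is its parent or a child of
  v, and children are deeper than v; so both neighbours on the cycle are the parent of v, although
  they are different.
\<close>

lemma undirected_acyclic_parent_tree: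
  fixes d :: "'a \<Rightarrow> nat"
  assumes dec: "\<And>v. v \<in> V \<Longrightarrow> v \<noteq> r \<Longrightarrow> d (q v) < d v"
  shows "undirected_acyclic (parent_tree V r q)"
  unfolding undirected_acyclic_def
proof
  let ?T = "parent_tree V r q"
  assume "\<exists>p. pre_digraph.cycle (with_proj ?T) p \<and> 3 \<le> length p"
  then obtain p u where cas: "pcas u p u" and arcs: "set p \<subseteq> parcs ?T"
    and dist: "distinct (tl (pawalk_verts u p))" and len: "3 \<le> length p"
    by (auto simp: pre_digraph.cycle_def pre_digraph.awalk_def cas_with_proj_eq
        awalk_verts_with_proj_eq)
  have "finite (snd ` set p)" "snd ` set p \<noteq> {}"
    using len by auto
  then have "Max (d ` snd ` set p) \<in> d ` snd ` set p"
    by (intro Max_in) auto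
  then obtain v where v: "v \<in> snd ` set p" and "d v = Max (d ` snd ` set p)"
    by (metis imageE)
  then have top: "\<And>w. w \<in> snd ` set p \<Longrightarrow> d w \<le> d v"
    by simp
  obtain j where j: "j < length p" "v = snd (p ! j)"
    using v by (auto simp: in_set_conv_nth)
  obtain a b where ab: "(a, v) \<in> set p" "(v, b) \<in> set p" "a \<noteq> b"
    and ab_top: "d a \<le> d v" "d b \<le> d v"
    using closed_walk_neighbours[OF cas j(1) len] dist top
    by (metis pawalk_verts_tl[OF cas] j(2))
  have "a = q v"
  proof -
    have "(a, v) \<in> parcs ?T" using ab arcs by auto
    then show ?thesis using dec[of a] ab_top by (auto simp: parcs_parent_tree)
  qed
  moreover have "b = q v"
  proof -
    have "(v, b) \<in> parcs ?T" using ab arcs by auto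
    then show ?thesis using dec[of b] ab_top by (auto simp: parcs_parent_tree)
  qed
  ultimately show False using ab by simp
qed

lemma undirected_spanning_tree_parent_tree:
  fixes d :: "'a \<Rightarrow> nat"
  assumes G: "pair_graph G" and r: "r \<in> pverts G"
    and par: "\<And>v. v \<in> pverts G \<Longrightarrow> v \<noteq> r \<Longrightarrow> (v, q v) \<in> parcs G \<and> d (q v) < d v"
  shows "undirected_spanning_tree (parent_tree (pverts G) r q) G"
proof -
  let ?T = "parent_tree (pverts G) r q"
  have sub: "parcs ?T \<subseteq> parcs G"
    using par pair_graph_symD[OF G] by (auto simp: parent_tree_def)
  have sym: "sym (parcs ?T)"
    by (auto simp: sym_def parcs_parent_tree)
  note T = pair_graph_spanning_subgraph[OF G pverts_parent_tree sub sym]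
  interpret T: pair_graph ?T by (rule T(1))
  have to_root: "v \<rightarrow>\<^sup>*\<^bsub>with_proj ?T\<^esub> r" if "v \<in> pverts G" for v
    using that
  proof (induction "d v" arbitrary: v rule: less_induct)
    case less
    show ?case
    proof (cases "v = r")
      case True
      then show ?thesis using less.prems by (simp add: reachable_def)
    next
      case False
      with less.prems par have "(v, q v) \<in> parcs G" "d (q v) < d v" by auto
      moreover from this have V: "q v \<in> pverts G"
        using G pair_wf_digraph.in_arcsD2
        by (metis pair_graph_def pair_digraph_def pair_fin_digraph_def)
      ultimately have "q v \<rightarrow>\<^sup>*\<^bsub>with_proj ?T\<^esub> r" "(v, q v) \<in> parcs ?T"
        using less False by (auto simp: parcs_parent_tree)
      then show ?thesis
        by (metis T.adj_reachable_trans)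
    qed
  qed
  have "u \<rightarrow>\<^sup>*\<^bsub>with_proj ?T\<^esub> v" if "u \<in> pverts G" "v \<in> pverts G" for u v
    using to_root[OF that(1)] T.symmetric_reachable'[OF to_root[OF that(2)]]
    by (rule T.reachable_trans)
  then have "Digraph_Component.connected (with_proj ?T)"
    unfolding connected_def strongly_connected_def
    using r T.pair_sym_arcs by (auto simp: T.reachable_mk_symmetric_eq)
  then show ?thesis
    using T undirected_acyclic_parent_tree[of "pverts G" r d q] par
    by (auto simp: undirected_spanning_tree_def)
qed

section \<open>Edges needed by two independent spanning trees\<close>

text \<open>
  A breadth-first parent function gives an edge to each vertex but the root, and each of these
  edges counts as two arcs.
\<close>

lemma connected_card_parcs:
  assumes T: "pair_graph T" and con: "Digraph_Component.connected (with_proj T)"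
  shows "2 * (card (pverts T) - 1) \<le> card (parcs T)"
proof -
  interpret T: pair_graph T by (rule T)
  have sc: "strongly_connected (with_proj T)"
    using con T.pair_sym_arcs T.symmetric_connected_imp_strongly_connected by blast
  then obtain r where r: "r \<in> pverts T"
    by (auto simp: strongly_connected_def)
  have to_r: "(v, r) \<in> (parcs T)\<^sup>*" if "v \<in> pverts T" for v
    using sc r that reachable_rtranclI[of "with_proj T" v r] by (auto simp: strongly_connected_def)
  obtain p and d :: "'a \<Rightarrow> nat"
    where p: "\<And>v. v \<in> pverts T \<Longrightarrow> v \<noteq> r \<Longrightarrow> (v, p v) \<in> parcs T \<and> d (p v) < d v"
    by (rule parent_function_exists[of "pverts T" r, OF to_r], assumption) (rule that, assumption)
  let ?V = "pverts T - {r}"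
  let ?up = "(\<lambda>v. (v, p v)) ` ?V" and ?down = "(\<lambda>v. (p v, v)) ` ?V"
  have "?up \<inter> ?down = {}"
  proof (intro equals0I)
    fix e assume "e \<in> ?up \<inter> ?down"
    then obtain v w where "v \<in> ?V" "w \<in> ?V" "v = p w" "p v = w" by auto
    then show False using p[of v] p[of w] by auto
  qed
  then have "card (?up \<union> ?down) = card ?up + card ?down"
    using T.pair_finite_verts by (intro card_Un_disjoint) auto
  also have "\<dots> = 2 * (card (pverts T) - 1)"
    using T.pair_finite_verts r by (simp add: card_image inj_on_def)
  finally have "card (?up \<union> ?down) = 2 * (card (pverts T) - 1)" .
  moreover have "?up \<union> ?down \<subseteq> parcs T"
    using p pair_graph_symD[OF T] by auto
  ultimately show ?thesis
    using card_mono[OF T.pair_finite_arcs, of "?up \<union> ?down"] by simp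
qed

text \<open>
  An edge common to two completely independent spanning trees would be a path in both of them,
  so the trees are edge-disjoint.
\<close>

lemma CISTs_card_parcs:
  assumes G: "pair_graph G" and "admits_two_CISTs G"
  shows "4 * (card (pverts G) - 1) \<le> card (parcs G)"
proof -
  interpret G: pair_graph G by (rule G)
  obtain T1 T2 where C: "completely_independent_spanning_trees G [T1, T2]"
    using assms(2) by (auto simp: admits_two_CISTs_def)
  have sub: "parcs T \<subseteq> parcs G" and V: "pverts T = pverts G"
    and bound: "2 * (card (pverts G) - 1) \<le> card (parcs T)" if "T \<in> {T1, T2}" for T
  proof -
    have T: "undirected_spanning_tree T G"
      using C that by (auto simp: completely_independent_spanning_trees_def)
    then show "parcs T \<subseteq> parcs G" and V: "pverts T = pverts G"
      by (auto simp: undirected_spanning_tree_def spanning_def subgraph_def)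
    show "2 * (card (pverts G) - 1) \<le> card (parcs T)"
      using T V connected_card_parcs[of T] by (simp add: undirected_spanning_tree_def)
  qed
  have "parcs T1 \<inter> parcs T2 = {}"
  proof (rule ccontr)
    assume "parcs T1 \<inter> parcs T2 \<noteq> {}"
    then obtain x y where xy: "(x, y) \<in> parcs T1" "(x, y) \<in> parcs T2" by auto
    then have "(x, y) \<in> parcs G"
      using sub by blast
    then have ends: "x \<in> pverts G" "y \<in> pverts G" "x \<noteq> y"
      using G.wellformed'[of x y] G.pair_no_loops[of "(x, y)"] by auto
    have path: "pre_digraph.apath (with_proj T) x [(x, y)] y" if "T \<in> {T1, T2}" for T
    proof -
      have "pverts T = pverts G" "(x, y) \<in> parcs T"
        using that V[OF that] xy by auto
      with ends show ?thesis
        by (auto simp: pre_digraph.apath_def pre_digraph.awalk_def cas_with_proj_eq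
            awalk_verts_with_proj_eq)
    qed
    have "openly_disjoint x y [(x, y)] [(x, y)]"
    proof -
      have "pre_digraph.apath (with_proj ([T1, T2] ! 0)) x [(x, y)] y"
        "pre_digraph.apath (with_proj ([T1, T2] ! 1)) x [(x, y)] y"
        using path by simp_all
      moreover have "(0::nat) < length [T1, T2]" "1 < length [T1, T2]" "(0::nat) \<noteq> 1"
        by simp_all
      ultimately show ?thesis
        using C ends unfolding completely_independent_spanning_trees_def by blast
    qed
    then show False
      by (simp add: openly_disjoint_def path_edges_def)
  qed
  then have "card (parcs T1) + card (parcs T2) = card (parcs T1 \<union> parcs T2)"
    using sub G.pair_finite_arcs by (metis card_Un_disjoint finite_subset insertCI)
  also have "\<dots> \<le> card (parcs G)"
    using sub G.pair_finite_arcs by (intro card_mono) auto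
  finally show ?thesis using bound[of T1] bound[of T2] by simp
qed

section \<open>Independent spanning trees from a two-colouring\<close>

text \<open>
  Assigning the edge {v, f v} to v is an injection from vertices to two-coloured edges. Such an
  injection exists if and only if no component of the bipartite graph of two-coloured edges is a
  tree.
\<close>

definition CIST_partition ::
    "'a pair_pre_digraph \<Rightarrow> ('a \<Rightarrow> bool) \<Rightarrow> ('a \<Rightarrow> 'a) \<Rightarrow> bool" where
  "CIST_partition G c f \<longleftrightarrow>
     (\<forall>u \<in> pverts G. \<forall>v \<in> pverts G. c u = c v \<longrightarrow>
        (u, v) \<in> {(a, b) \<in> parcs G. c a = c b}\<^sup>*) \<and>
     (\<forall>v \<in> pverts G. (v, f v) \<in> parcs G \<and> c (f v) \<noteq> c v \<and> f (f v) \<noteq> v)"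

text \<open>
  The tree for colour b: vertices of colour b have their parents within their class, every other
  vertex is attached to its partner. As the parent of any vertex has colour b, a vertex of the
  other colour has no children and its partner is its only neighbour.
\<close>

lemma colour_class_tree:
  assumes G: "pair_graph G" and P: "CIST_partition G c f" and ne: "pverts G \<noteq> {}"
  obtains T where "undirected_spanning_tree T G"
    "\<And>v w. (v, w) \<in> parcs T \<Longrightarrow> c v \<noteq> b \<Longrightarrow> w = f v \<and> c w = b"
proof -
  interpret G: pair_graph G by (rule G)
  let ?A = "{v \<in> pverts G. c v = b}"
  have f: "(v, f v) \<in> parcs G" "f v \<in> pverts G" "c (f v) \<noteq> c v" if "v \<in> pverts G" for v
    using P that G.in_arcsD2 by (auto simp: CIST_partition_def)
  obtain r where r: "r \<in> pverts G" "c r = b"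
    using ne f by (metis ex_in_conv)
  have to_r: "\<And>v. v \<in> ?A \<Longrightarrow> (v, r) \<in> {(a, b) \<in> parcs G. c a = c b}\<^sup>*"
    using P r by (auto simp: CIST_partition_def)
  obtain p and d :: "'a \<Rightarrow> nat"
    where p: "\<And>v. v \<in> ?A \<Longrightarrow> v \<noteq> r \<Longrightarrow>
      (v, p v) \<in> {(a, b) \<in> parcs G. c a = c b} \<and> d (p v) < d v"
    by (rule parent_function_exists[of ?A r, OF to_r], assumption) (rule that, assumption)
  define q where "q v = (if c v = b then p v else f v)" for v
  \<comment> \<open>Leaves have to be deeper than the vertices to which they are attached.\<close>
  define e where "e v = (if c v = b then d v else Suc (d (f v)))" for v
  have q: "(v, q v) \<in> parcs G \<and> e (q v) < e v" and cq: "c (q v) = b"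
    if "v \<in> pverts G" "v \<noteq> r" for v
    using p[of v] f[of v] that by (auto simp: q_def e_def)
  show thesis
  proof (rule that)
    show "undirected_spanning_tree (parent_tree (pverts G) r q) G"
      using G r(1) q by (rule undirected_spanning_tree_parent_tree)
    show "w = f v \<and> c w = b"
      if "(v, w) \<in> parcs (parent_tree (pverts G) r q)" "c v \<noteq> b" for v w
    proof -
      have "v \<in> pverts G" "v \<noteq> r" "w = q v"
        using that cq[of w] r by (auto simp: parcs_parent_tree)
      then show ?thesis
        using cq[of v] that(2) by (simp add: q_def)
    qed
  qed
qed

lemma apath_interior_neighbours:
  assumes "pcas x p y" "distinct (pawalk_verts x p)"
    and "v \<in> set (pawalk_verts x p)" "v \<noteq> x" "v \<noteq> y"
  shows "\<exists>a b. a \<noteq> b \<and> (a, v) \<in> set p \<and> (v, b) \<in> set p"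
  using assms
proof (induction p arbitrary: x)
  case (Cons e es)
  then obtain z where e: "e = (x, z)" by (cases e) auto
  show ?case
  proof (cases "v = z")
    case True
    with Cons.prems e obtain b es' where es: "es = (z, b) # es'"
      by (cases es) auto
    have "b \<noteq> x" using Cons.prems e es by (cases es') auto
    with e es True show ?thesis by (intro exI[of _ x] exI[of _ b]) auto
  next
    case False
    with Cons e show ?thesis by fastforce
  qed
qed simp

lemma CIST_partition_imp_two_CISTs:
  assumes G: "pair_graph G" and P: "CIST_partition G c f" and ne: "pverts G \<noteq> {}"
  shows "admits_two_CISTs G"
proof -
  have "\<exists>T. undirected_spanning_tree T G \<and>
      (\<forall>v w. (v, w) \<in> parcs T \<longrightarrow> c v \<noteq> b \<longrightarrow> w = f v \<and> c w = b)" for b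
    using colour_class_tree[OF G P ne, of b] by metis
  then obtain T where tree: "\<And>b. undirected_spanning_tree (T b) G"
    and leaf: "\<And>b v w. (v, w) \<in> parcs (T b) \<Longrightarrow> c v \<noteq> b \<Longrightarrow> w = f v \<and> c w = b"
    by metis
  have V: "pverts (T b) = pverts G" and sym: "(v, w) \<in> parcs (T b) \<Longrightarrow> (w, v) \<in> parcs (T b)"
    and inV: "(v, w) \<in> parcs (T b) \<Longrightarrow> v \<in> pverts G" for b v w
    using tree[of b] pair_graph_symD[of "T b"]
    by (auto simp: undirected_spanning_tree_def spanning_def subgraph_def
        dest: wf_digraph.tail_in_verts)
  have arc_disjoint: "\<not> ((v, w) \<in> parcs (T b) \<and> (v, w) \<in> parcs (T (\<not> b)))" for b v w
  proof
    assume vw: "(v, w) \<in> parcs (T b) \<and> (v, w) \<in> parcs (T (\<not> b))"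
    \<comment> \<open>Of the two trees, the one for the colour that v does not have shows \<open>w = f v\<close>;
      this makes w a leaf of the other tree, which shows \<open>v = f w\<close>.\<close>
    define b' where "b' = (\<not> c v)"
    have T: "(v, w) \<in> parcs (T b')" "(v, w) \<in> parcs (T (\<not> b'))"
      using vw by (cases b; cases b'; simp)+
    have "w = f v" "c w = b'" using leaf[OF T(1)] by (auto simp: b'_def)
    moreover have "v = f w" using leaf[OF sym[OF T(2)]] \<open>c w = b'\<close> by auto
    ultimately show False
      using P inV[OF T(1)] by (auto simp: CIST_partition_def)
  qed
  have interior: "c v = b"
    if path: "pre_digraph.apath (with_proj (T b)) x p y" and v: "v \<in> set (pawalk_verts x p)" "v \<noteq> x" "v \<noteq> y"
    for b x p y v
  proof (rule ccontr)
    assume "c v \<noteq> b"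
    have p: "pcas x p y" "distinct (pawalk_verts x p)" "set p \<subseteq> parcs (T b)"
      using path by (auto simp: pre_digraph.apath_def pre_digraph.awalk_def
          cas_with_proj_eq awalk_verts_with_proj_eq)
    obtain a a' where "a \<noteq> a'" "(a, v) \<in> parcs (T b)" "(v, a') \<in> parcs (T b)"
      using apath_interior_neighbours[OF p(1,2) v] p(3) by blast
    with leaf[OF _ \<open>c v \<noteq> b\<close>] sym show False by metis
  qed
  have disjoint: "openly_disjoint x y p q"
    if p: "pre_digraph.apath (with_proj (T b)) x p y"
      and q: "pre_digraph.apath (with_proj (T (\<not> b))) x q y" for b x y p q
  proof -
    have arcs: "set p \<subseteq> parcs (T b)" "set q \<subseteq> parcs (T (\<not> b))"
      using p q by (auto simp: pre_digraph.apath_def pre_digraph.awalk_def)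
    have "path_edges p \<inter> path_edges q = {}"
    proof (rule ccontr)
      assume "path_edges p \<inter> path_edges q \<noteq> {}"
      then obtain v w v' w' where "(v, w) \<in> set p" "(v', w') \<in> set q" "{v, w} = {v', w'}"
        by (auto simp: path_edges_def)
      then have "(v, w) \<in> parcs (T b) \<and> (v, w) \<in> parcs (T (\<not> b))"
        using arcs sym by (auto simp: doubleton_eq_iff)
      then show False using arc_disjoint by blast
    qed
    moreover have "set (pawalk_verts x p) \<inter> set (pawalk_verts x q) \<subseteq> {x, y}"
      using interior[OF p] interior[OF q] by blast
    ultimately show ?thesis by (simp add: openly_disjoint_def)
  qed
  have "completely_independent_spanning_trees G [T True, T False]"
    unfolding completely_independent_spanning_trees_def
    using tree disjoint[of True] disjoint[of False]
    by (auto simp: less_Suc_eq)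
  then show ?thesis
    by (auto simp: admits_two_CISTs_def)
qed

section \<open>Adjacency in the dual-cube as flipping a bit\<close>

definition flip :: "nat \<Rightarrow> bool list \<Rightarrow> bool list" where
  "flip i u = u[length u - i := \<not> bit_at u i]"

text \<open>
  The positions at which a vertex u has a neighbour: the top position and, according to the top
  bit of u, the positions of the high or of the low block.
\<close>

definition free_position :: "nat \<Rightarrow> bool list \<Rightarrow> nat \<Rightarrow> bool" where
  "free_position n u i \<longleftrightarrow>
     i = 2*n-1 \<or> (if bit_at u (2*n-1) then n \<le> i \<and> i \<le> 2*n-2 else 1 \<le> i \<and> i \<le> n-1)"

lemma bit_list_eqI:
  assumes "length u = m" "length v = m" "\<And>k. 1 \<le> k \<Longrightarrow> k \<le> m \<Longrightarrow> bit_at u k = bit_at v k"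
  shows "u = v"
proof (rule nth_equalityI)
  fix j assume "j < length u"
  then show "u ! j = v ! j"
    using assms(1,2) assms(3)[of "m - j"] by (simp add: bit_at_def)
qed (use assms in simp)

lemma length_flip [simp]: "length (flip i u) = length u"
  by (simp add: flip_def)

lemma bit_at_flip:
  assumes "1 \<le> i" "i \<le> length u" "1 \<le> k" "k \<le> length u"
  shows "bit_at (flip i u) k = (bit_at u k \<noteq> (k = i))"
proof -
  have "length u - i = length u - k \<longleftrightarrow> k = i" "length u - i < length u"
    using assms by auto
  then show ?thesis
    by (auto simp: flip_def bit_at_def nth_list_update)
qed

lemma free_position_bounds:
  "n \<ge> 1 \<Longrightarrow> free_position n u i \<Longrightarrow> 1 \<le> i \<and> i \<le> 2*n-1"
  by (auto simp: free_position_def split: if_splits)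

lemma dual_cube_arc_iff:
  assumes n: "n \<ge> 1"
  shows "(u, v) \<in> parcs (dual_cube n) \<longleftrightarrow>
    length u = 2*n-1 \<and> (\<exists>i. free_position n u i \<and> v = flip i u)"
proof
  assume L: "(u, v) \<in> parcs (dual_cube n)"
  then have len: "length u = 2*n-1" "length v = 2*n-1" and "dual_cube_adj n u v"
    by (auto simp: dual_cube_def)
  then obtain i where i: "1 \<le> i" "i \<le> 2*n-1"
    and diff: "{j \<in> {1..2*n-1}. bit_at u j \<noteq> bit_at v j} = {i}"
    and low: "i \<le> n-1 \<Longrightarrow> \<not> bit_at u (2*n-1)"
    and high: "n \<le> i \<Longrightarrow> i \<le> 2*n-2 \<Longrightarrow> bit_at u (2*n-1)"
    unfolding dual_cube_adj_def by auto
  have "v = flip i u"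
  proof (rule bit_list_eqI[of _ "2*n-1"])
    fix k assume "1 \<le> k" "k \<le> 2*n-1"
    moreover from this have "bit_at u k \<noteq> bit_at v k \<longleftrightarrow> k = i"
      using diff by (auto simp: set_eq_iff)
    ultimately show "bit_at v k = bit_at (flip i u) k"
      using i len by (auto simp: bit_at_flip)
  qed (use len in simp_all)
  moreover have "free_position n u i"
    unfolding free_position_def
  proof (cases "i \<le> n-1")
    case False
    moreover have "n \<le> i" "i \<noteq> 2*n-1 \<Longrightarrow> i \<le> 2*n-2" using False i by auto
    ultimately show "i = 2*n-1 \<or>
        (if bit_at u (2*n-1) then n \<le> i \<and> i \<le> 2*n-2 else 1 \<le> i \<and> i \<le> n-1)"
      using high by auto
  qed (use i low in auto)
  ultimately show "length u = 2*n-1 \<and> (\<exists>i. free_position n u i \<and> v = flip i u)"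
    using len by blast
next
  assume "length u = 2*n-1 \<and> (\<exists>i. free_position n u i \<and> v = flip i u)"
  then obtain i where len: "length u = 2*n-1" and i: "free_position n u i" and v: "v = flip i u"
    by blast
  note bounds = free_position_bounds[OF n i]
  have "dual_cube_adj n u v"
    unfolding dual_cube_adj_def
  proof (intro bexI[of _ i] conjI)
    show "{j \<in> {1..2*n-1}. bit_at u j \<noteq> bit_at v j} = {i}"
      using bounds len by (auto simp: v bit_at_flip)
  qed (use i bounds len n in \<open>auto simp: v free_position_def bit_at_flip split: if_splits\<close>)
  then show "(u, v) \<in> parcs (dual_cube n)"
    using len by (simp add: dual_cube_def v)
qed

lemma pverts_dual_cube: "pverts (dual_cube n) = {u. length u = 2*n-1}"
  by (simp add: dual_cube_def)

lemma card_pverts_dual_cube: "card (pverts (dual_cube n)) = 2 ^ (2*n-1)"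
  using card_lists_length_eq[of "UNIV :: bool set" "2*n-1"]
  by (simp add: pverts_dual_cube card_UNIV_bool)

lemma card_parcs_dual_cube:
  assumes n: "n \<ge> 1"
  shows "card (parcs (dual_cube n)) \<le> n * 2 ^ (2*n-1)"
proof -
  let ?V = "pverts (dual_cube n)"
  let ?P = "\<lambda>u. {i. free_position n u i}"
  have P: "finite (?P u) \<and> card (?P u) = n" for u
  proof (cases "bit_at u (2*n-1)")
    case True
    then have "?P u = {n..2*n-1}"
      using n by (auto simp: free_position_def)
    then show ?thesis using n by simp
  next
    case False
    then have "?P u = insert (2*n-1) {1..n-1}"
      using n by (auto simp: free_position_def)
    moreover have "2*n-1 \<notin> {1..n-1}" using n by auto
    ultimately show ?thesis using n by simp
  qed
  have finV: "finite ?V"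
    using pair_graph_dual_cube[of n]
    by (simp add: pair_graph_def pair_digraph_def pair_fin_digraph.pair_finite_verts)
  have "parcs (dual_cube n) \<subseteq> (\<lambda>(u, i). (u, flip i u)) ` Sigma ?V ?P"
    by (auto simp: dual_cube_arc_iff[OF n] pverts_dual_cube)
  then have "card (parcs (dual_cube n)) \<le> card (Sigma ?V ?P)"
    using finV P by (meson card_image_le card_mono finite_SigmaI finite_imageI le_trans)
  also have "\<dots> = n * 2 ^ (2*n-1)"
    using finV P by (simp add: card_pverts_dual_cube)
  finally show ?thesis .
qed

text \<open>
  In arcs, \<open>4 * (2 ^ (2*n-1) - 1)\<close> are needed and at most \<open>n * 2 ^ (2*n-1)\<close> available:
  4 against 2, 28 against 16, 124 against 96.
\<close>

lemma two_CISTs_imp_ge_4: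
  assumes n: "n \<ge> 1" and "admits_two_CISTs (dual_cube n)"
  shows "n \<ge> 4"
proof (rule ccontr)
  assume "\<not> n \<ge> 4"
  with n have "n = 1 \<or> n = 2 \<or> n = 3" by auto
  moreover have "4 * (2 ^ (2*n-1) - 1) \<le> n * 2 ^ (2*n-1)"
    using CISTs_card_parcs[OF pair_graph_dual_cube assms(2)] card_parcs_dual_cube[OF n]
    by (simp add: card_pverts_dual_cube)
  ultimately show False by auto
qed

section \<open>From one dimension to the next\<close>

text \<open>
  A vertex of the n-dimensional cube is its top bit, followed by the high and then the low block of
  \<open>n - 1\<close> bits each. The new bit x is put at the head of the high block (position \<open>2*n\<close> of the
  result) and y at the head of the low block (position \<open>n\<close>).
\<close>

definition insert_bits :: "nat \<Rightarrow> bool \<Rightarrow> bool \<Rightarrow> bool list \<Rightarrow> bool list" where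
  "insert_bits n x y u = hd u # x # take (n-1) (tl u) @ y # drop n u"

definition remove_bits :: "nat \<Rightarrow> bool list \<Rightarrow> bool list" where
  "remove_bits n w = hd w # take (n-1) (drop 2 w) @ drop (n+2) w"

lemma length_insert_bits:
  "n \<ge> 1 \<Longrightarrow> length u = 2*n-1 \<Longrightarrow> length (insert_bits n x y u) = 2*n+1"
  by (simp add: insert_bits_def)

lemma length_remove_bits:
  "n \<ge> 1 \<Longrightarrow> length w = 2*n+1 \<Longrightarrow> length (remove_bits n w) = 2*n-1"
  by (simp add: remove_bits_def)

lemma remove_insert_bits:
  assumes "n \<ge> 1" "length u = 2*n-1"
  shows "remove_bits n (insert_bits n x y u) = u"
proof -
  obtain t us m where "u = t # us" "n = Suc m" "length us = 2*m"
    using assms by (cases u; cases n) auto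
  then show ?thesis
    by (simp add: remove_bits_def insert_bits_def)
qed

lemma insert_remove_bits:
  assumes "n \<ge> 1" "length w = 2*n+1"
  shows "insert_bits n (w ! 1) (w ! (n+1)) (remove_bits n w) = w"
proof -
  obtain t x us m where "w = t # x # us" "n = Suc m" "length us = Suc (2*m)"
    using assms by (cases w; cases "tl w"; cases n) auto
  then show ?thesis
    by (simp add: remove_bits_def insert_bits_def id_take_nth_drop[of m us, symmetric])
qed

lemma bit_at_insert_bits:
  assumes "n \<ge> 1" "length u = 2*n-1" "1 \<le> k" "k \<le> 2*n+1"
  shows "bit_at (insert_bits n x y u) k =
    (if k < n then bit_at u k else if k = n then y else if k < 2*n then bit_at u (k-1)
     else if k = 2*n then x else bit_at u (2*n-1))"
proof -
  obtain t us m where u: "u = t # us" and m: "n = Suc m" "length us = 2*m"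
    using assms by (cases u; cases n) auto
  show ?thesis
    using assms(3,4) m
    by (auto simp: u bit_at_def insert_bits_def nth_Cons' nth_append
        intro!: arg_cong[of _ _ "nth us"])
qed

text \<open>
  Insertion shifts the high block up by one position and the top bit by two; low, high and top
  positions keep their role, so flipping one of them is still allowed.
\<close>

lemma insert_bits_arc:
  assumes n: "n \<ge> 1" and uv: "(u, v) \<in> parcs (dual_cube n)"
  shows "(insert_bits n x y u, insert_bits n x y v) \<in> parcs (dual_cube (Suc n))"
proof -
  obtain i where len: "length u = 2*n-1" and i: "free_position n u i" and v: "v = flip i u"
    using uv dual_cube_arc_iff[OF n] by auto
  define j where "j = (if i < n then i else if i = 2*n-1 then 2*n+1 else Suc i)"
  note bounds = free_position_bounds[OF n i]
  let ?w = "insert_bits n x y u"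
  have lenw: "length ?w = 2*n+1" using n len by (rule length_insert_bits)
  have j: "1 \<le> j" "j \<le> 2*n+1" using bounds by (auto simp: j_def)
  have "insert_bits n x y v = flip j ?w"
  proof (rule bit_list_eqI[of _ "2*n+1"])
    fix k assume k: "1 \<le> k" "k \<le> 2*n+1"
    show "bit_at (insert_bits n x y v) k = bit_at (flip j ?w) k"
      using k j bounds n len lenw
      by (auto simp: v bit_at_flip bit_at_insert_bits j_def)
  qed (use n len lenw in \<open>simp_all add: v length_insert_bits\<close>)
  moreover have "free_position (Suc n) ?w j"
    using i n len bounds
    by (auto simp: free_position_def bit_at_insert_bits j_def split: if_splits)
  ultimately show ?thesis
    using lenw by (auto simp: dual_cube_arc_iff)
qed

lemma inserted_low_arc:
  assumes n: "n \<ge> 1" and len: "length u = 2*n-1" and top: "\<not> bit_at u (2*n-1)"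
  shows "(insert_bits n x y u, insert_bits n x (\<not> y) u) \<in> parcs (dual_cube (Suc n))"
proof -
  let ?w = "insert_bits n x y u"
  have lenw: "length ?w = 2*n+1" using n len by (rule length_insert_bits)
  have "insert_bits n x (\<not> y) u = flip n ?w"
    by (rule bit_list_eqI[of _ "2*n+1"])
      (use n len lenw in \<open>simp_all add: bit_at_flip bit_at_insert_bits length_insert_bits\<close>)
  moreover have "free_position (Suc n) ?w n"
    using n len top by (simp add: free_position_def bit_at_insert_bits)
  ultimately show ?thesis
    using lenw by (auto simp: dual_cube_arc_iff)
qed

lemma inserted_high_arc:
  assumes n: "n \<ge> 1" and len: "length u = 2*n-1" and top: "bit_at u (2*n-1)"
  shows "(insert_bits n x y u, insert_bits n (\<not> x) y u) \<in> parcs (dual_cube (Suc n))"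
proof -
  let ?w = "insert_bits n x y u"
  have lenw: "length ?w = 2*n+1" using n len by (rule length_insert_bits)
  have "insert_bits n (\<not> x) y u = flip (2*n) ?w"
    by (rule bit_list_eqI[of _ "2*n+1"])
      (use n len lenw in \<open>simp_all add: bit_at_flip bit_at_insert_bits length_insert_bits\<close>)
  moreover have "free_position (Suc n) ?w (2*n)"
    using n len top by (simp add: free_position_def bit_at_insert_bits)
  ultimately show ?thesis
    using lenw by (auto simp: dual_cube_arc_iff)
qed

text \<open>
  A class consists of the vertices with a given top bit. The edges between the copies of the
  smaller cube that change the low bit are found in one class, those that change the high bit in
  the other, so each colour needs vertices in both in order to reach all copies.
\<close>

definition meets_both_classes :: "nat \<Rightarrow> (bool list \<Rightarrow> bool) \<Rightarrow> bool" where
  "meets_both_classes n c \<longleftrightarrow> (\<forall>b t. \<exists>u. length u = 2*n-1 \<and> c u = b \<and> bit_at u (2*n-1) = t)"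

lemma CIST_partition_extends:
  assumes n: "n \<ge> 1" and P: "CIST_partition (dual_cube n) c f" and M: "meets_both_classes n c"
  defines "c' \<equiv> \<lambda>w. c (remove_bits n w)"
    and "f' \<equiv> \<lambda>w. insert_bits n (w ! 1) (w ! (n+1)) (f (remove_bits n w))"
  shows "CIST_partition (dual_cube (Suc n)) c' f' \<and> meets_both_classes (Suc n) c'"
proof
  let ?R = "{(a, b) \<in> parcs (dual_cube n). c a = c b}"
  let ?R' = "{(a, b) \<in> parcs (dual_cube (Suc n)). c' a = c' b}"
  have c': "c' (insert_bits n x y u) = c u" if "length u = 2*n-1" for x y u
    using that n by (simp add: c'_def remove_insert_bits)
  \<comment> \<open>Within a copy, a walk in the smaller cube is followed. To change the low bit, walk to a vertex
    of the same colour with top bit 0, cross to the other copy and walk on from there; likewise for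
    the high bit with a vertex with top bit 1.\<close>
  have copy: "(insert_bits n x y u, insert_bits n x y v) \<in> ?R'\<^sup>*"
    if "length u = 2*n-1" "length v = 2*n-1" "c u = c v" for x y u v
  proof -
    have "(u, v) \<in> ?R\<^sup>*"
      using P that by (simp add: CIST_partition_def pverts_dual_cube)
    then show ?thesis
    proof induction
      case (step v w)
      then have vw: "(v, w) \<in> parcs (dual_cube n)" "c v = c w" by auto
      moreover from this have "length v = 2*n-1" "length w = 2*n-1"
        by (auto simp: dual_cube_def)
      ultimately have "(insert_bits n x y v, insert_bits n x y w) \<in> ?R'"
        using insert_bits_arc[OF n vw(1)] by (auto simp: c')
      with step.IH show ?case by (rule rtrancl_into_rtrancl)
    qed simp
  qed
  have low: "(insert_bits n x y u, insert_bits n x y' v) \<in> ?R'\<^sup>*"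
    if uv: "length u = 2*n-1" "length v = 2*n-1" "c u = c v" for x y y' u v
  proof (cases "y' = y")
    case False
    obtain w where w: "length w = 2*n-1" "c w = c u" "\<not> bit_at w (2*n-1)"
      using M[unfolded meets_both_classes_def, THEN spec, THEN spec, of "c u" False] by auto
    have "(insert_bits n x y w, insert_bits n x y' w) \<in> ?R'"
      using inserted_low_arc[OF n w(1,3), of x y] False w(1) by (cases y; cases y') (auto simp: c')
    then have "(insert_bits n x y u, insert_bits n x y' w) \<in> ?R'\<^sup>*"
      using copy[of u w x y] uv w by (meson rtrancl_into_rtrancl)
    also have "(insert_bits n x y' w, insert_bits n x y' v) \<in> ?R'\<^sup>*"
      using copy[of w v x y'] uv w by simp
    finally show ?thesis .
  qed (use copy uv in auto)
  have joined: "(insert_bits n x y u, insert_bits n x' y' v) \<in> ?R'\<^sup>*"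
    if uv: "length u = 2*n-1" "length v = 2*n-1" "c u = c v" for x x' y y' u v
  proof (cases "x' = x")
    case False
    obtain w where w: "length w = 2*n-1" "c w = c u" "bit_at w (2*n-1)"
      using M[unfolded meets_both_classes_def, THEN spec, THEN spec, of "c u" True] by auto
    have "(insert_bits n x y w, insert_bits n x' y w) \<in> ?R'"
      using inserted_high_arc[OF n w(1,3), of x y] False w(1) by (cases x; cases x') (auto simp: c')
    then have "(insert_bits n x y u, insert_bits n x' y w) \<in> ?R'\<^sup>*"
      using copy[of u w x y] uv w by (meson rtrancl_into_rtrancl)
    also have "(insert_bits n x' y w, insert_bits n x' y' v) \<in> ?R'\<^sup>*"
      using low[of w v x' y y'] uv w by simp
    finally show ?thesis .
  qed (use low uv in auto)
  have copy_of: "insert_bits n (w ! 1) (w ! (n+1)) (remove_bits n w) = w"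
    "length (remove_bits n w) = 2*n-1" if "length w = 2 * Suc n - 1" for w
    using that n insert_remove_bits[of n w] length_remove_bits[of n w] by simp_all
  show "CIST_partition (dual_cube (Suc n)) c' f'"
    unfolding CIST_partition_def pverts_dual_cube
  proof (intro conjI ballI impI)
    fix v w :: "bool list"
    assume "v \<in> {u. length u = 2 * Suc n - 1}" "w \<in> {u. length u = 2 * Suc n - 1}"
      and same: "c' v = c' w"
    then have lv: "length v = 2 * Suc n - 1" and lw: "length w = 2 * Suc n - 1" by simp_all
    have "(insert_bits n (v ! 1) (v ! (n+1)) (remove_bits n v),
        insert_bits n (w ! 1) (w ! (n+1)) (remove_bits n w)) \<in> ?R'\<^sup>*"
    proof (rule joined)
      show "c (remove_bits n v) = c (remove_bits n w)"
        using same by (simp add: c'_def)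
    qed (fact copy_of(2)[OF lv] copy_of(2)[OF lw])+
    then show "(v, w) \<in> ?R'\<^sup>*"
      unfolding copy_of(1)[OF lv] copy_of(1)[OF lw] .
  next
    fix w :: "bool list"
    assume "w \<in> {u. length u = 2 * Suc n - 1}"
    then have lw: "length w = 2 * Suc n - 1" by simp
    let ?u = "remove_bits n w"
    have u: "(?u, f ?u) \<in> parcs (dual_cube n)" "c (f ?u) \<noteq> c ?u" "f (f ?u) \<noteq> ?u"
      using P copy_of(2)[OF lw] by (simp_all add: CIST_partition_def pverts_dual_cube)
    then have lf: "length (f ?u) = 2*n-1" by (simp add: dual_cube_def)
    show "(w, f' w) \<in> parcs (dual_cube (Suc n))"
      using insert_bits_arc[OF n u(1), of "w ! 1" "w ! (n+1)"]
      unfolding copy_of(1)[OF lw] f'_def .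
    show "c' (f' w) \<noteq> c' w"
      using u(2) n lf by (simp add: f'_def c'_def remove_insert_bits)
    show "f' (f' w) \<noteq> w"
    proof
      assume "f' (f' w) = w"
      then have "remove_bits n (f' (f' w)) = ?u" by simp
      moreover have "remove_bits n (f' w) = f ?u"
        using n lf by (simp add: f'_def remove_insert_bits)
      moreover have "length (f (f ?u)) = 2*n-1"
        using P lf by (auto simp: CIST_partition_def dual_cube_def)
      ultimately have "f (f ?u) = ?u"
        using n by (simp add: f'_def remove_insert_bits)
      with u(3) show False by simp
    qed
  qed
  show "meets_both_classes (Suc n) c'"
    unfolding meets_both_classes_def
  proof (intro allI)
    fix b t
    obtain u where "length u = 2*n-1" "c u = b" "bit_at u (2*n-1) = t"
      using M[unfolded meets_both_classes_def, THEN spec, THEN spec, of b t] by auto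
    then show "\<exists>w. length w = 2 * Suc n - 1 \<and> c' w = b \<and> bit_at w (2 * Suc n - 1) = t"
      using n by (intro exI[of _ "insert_bits n False False u"])
        (simp add: c' length_insert_bits bit_at_insert_bits)
  qed
qed

section \<open>The four-dimensional dual-cube\<close>

text \<open>
  In each of the following tables, the bit string of a vertex is read as a binary number and the
  entries are listed in this order, eight to a row. The tables give the colour; the position to
  flip in order to reach the parent in a spanning tree of the colour class, with 0 at the two roots;
  the depth in that tree; and the position to flip in order to reach the partner.

  The colouring is antisymmetric: complementing the top bit and exchanging the high and the low
  block is an automorphism of the cube which exchanges the two colours. It has been found among
  the colourings with this symmetry by minimising the number of superfluous components, that is,
  of further components of the colour classes and of tree components between them.
\<close>

definition colour_bits :: "nat list list" where
  "colour_bits = [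
    [0, 1, 0, 0, 0, 1, 1, 1], [1, 0, 1, 0, 0, 0, 1, 1],
    [0, 1, 1, 1, 0, 0, 1, 0], [1, 1, 0, 1, 0, 0, 0, 1],
    [1, 0, 1, 0, 1, 1, 0, 0], [0, 1, 1, 0, 0, 1, 0, 0],
    [0, 0, 1, 1, 0, 1, 0, 1], [1, 1, 1, 0, 1, 0, 1, 0],
    [1, 0, 1, 0, 0, 1, 1, 0], [0, 1, 0, 0, 1, 0, 1, 0],
    [1, 0, 0, 1, 0, 0, 0, 0], [1, 1, 0, 0, 1, 1, 0, 1],
    [1, 1, 1, 1, 0, 1, 1, 0], [0, 1, 1, 1, 0, 0, 0, 1],
    [0, 0, 0, 1, 1, 1, 1, 0], [0, 0, 1, 0, 1, 1, 0, 1]]"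

definition parent_positions :: "nat list list" where
  "parent_positions = [
    [3, 3, 2, 1, 7, 7, 1, 2], [2, 2, 3, 7, 1, 3, 7, 1],
    [3, 2, 1, 7, 7, 1, 3, 2], [7, 1, 3, 2, 2, 1, 7, 3],
    [0, 2, 2, 3, 3, 1, 1, 7], [3, 7, 7, 3, 7, 3, 2, 1],
    [7, 1, 1, 3, 3, 7, 2, 2], [2, 1, 7, 7, 3, 2, 3, 3],
    [6, 5, 6, 7, 0, 6, 7, 5], [6, 5, 5, 4, 5, 7, 4, 4],
    [5, 6, 4, 6, 5, 7, 4, 7], [4, 7, 7, 5, 6, 6, 6, 7],
    [7, 4, 7, 5, 6, 7, 6, 6], [7, 6, 4, 4, 4, 6, 7, 5],
    [4, 7, 6, 7, 4, 5, 5, 6], [5, 4, 5, 6, 7, 4, 5, 6]]"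

definition depths :: "nat list list" where
  "depths = [
    [2, 6, 3, 4, 1, 5, 7, 6], [12, 8, 11, 7, 10, 9, 10, 11],
    [3, 11, 11, 10, 2, 3, 12, 4], [5, 6, 9, 7, 9, 10, 8, 8],
    [0, 10, 1, 9, 1, 2, 9, 8], [4, 10, 4, 6, 3, 11, 4, 5],
    [8, 9, 8, 7, 9, 5, 10, 6], [6, 7, 5, 9, 7, 11, 6, 10],
    [2, 12, 3, 5, 0, 4, 8, 6], [6, 8, 11, 6, 10, 10, 9, 7],
    [3, 11, 11, 9, 1, 4, 8, 5], [4, 7, 10, 7, 9, 6, 7, 9],
    [1, 10, 2, 9, 1, 3, 9, 7], [5, 9, 3, 10, 2, 11, 5, 11],
    [7, 10, 12, 8, 9, 4, 10, 6], [6, 11, 4, 8, 8, 5, 6, 10]]"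

definition partner_positions :: "nat list list" where
  "partner_positions = [
    [1, 7, 7, 2, 2, 1, 3, 3], [7, 1, 1, 3, 3, 2, 2, 7],
    [2, 1, 7, 3, 2, 3, 7, 1], [2, 3, 1, 7, 3, 7, 1, 2],
    [1, 7, 3, 1, 7, 3, 2, 2], [1, 2, 2, 1, 1, 7, 3, 2],
    [2, 3, 3, 2, 7, 1, 1, 7], [7, 7, 1, 2, 1, 3, 7, 1],
    [7, 4, 4, 6, 4, 4, 5, 7], [4, 7, 7, 6, 7, 5, 6, 6],
    [7, 7, 5, 5, 4, 5, 6, 4], [5, 4, 6, 4, 7, 4, 5, 5],
    [5, 6, 5, 7, 5, 4, 7, 4], [4, 5, 6, 7, 6, 5, 4, 7],
    [6, 5, 7, 4, 6, 6, 7, 4], [6, 6, 4, 5, 5, 7, 4, 7]]"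

definition bits_value :: "bool list \<Rightarrow> nat" where
  "bits_value = foldl (\<lambda>k b. if b then Suc (k + k) else k + k) 0"

definition entry :: "nat list list \<Rightarrow> bool list \<Rightarrow> nat" where
  "entry t u = t ! bits_value (take 4 u) ! bits_value (drop 4 u)"

definition colour4 :: "bool list \<Rightarrow> bool" where
  "colour4 u \<longleftrightarrow> entry colour_bits u = 1"

definition parent4 :: "bool list \<Rightarrow> bool list" where
  "parent4 u = flip (entry parent_positions u) u"

definition partner4 :: "bool list \<Rightarrow> bool list" where
  "partner4 u = flip (entry partner_positions u) u"

definition root4 :: "bool \<Rightarrow> bool list" where
  "root4 b = (if b then [False, True, False, False, False, False, False]
              else [True, False, False, False, True, False, False])"

text \<open>
  Reduces a statement on all bit strings of a given length to a finite computation.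
\<close>

lemma n_lists_check:
  assumes "list_all P (List.n_lists m [False, True])" "length u = m"
  shows "P u"
proof -
  have "u \<in> set (List.n_lists m [False, True])"
    using assms(2) by (auto simp: set_n_lists)
  then show ?thesis using assms(1) by (auto simp: list_all_iff)
qed

lemma partner_check:
  "list_all (\<lambda>u. free_position 4 u (entry partner_positions u) \<and>
     colour4 (partner4 u) \<noteq> colour4 u \<and> partner4 (partner4 u) \<noteq> u)
   (List.n_lists 7 [False, True])"
  by code_simp

text \<open>
  Decreasing depth makes sure that following the parents ends in the root.
\<close>

lemma parent_check:
  "list_all (\<lambda>u. u = root4 (colour4 u) \<or> 
     free_position 4 u (entry parent_positions u) \<and>
     colour4 (parent4 u) = colour4 u \<and> entry depths (parent4 u) < entry depths u)
   (List.n_lists 7 [False, True])"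
  by code_simp

lemma class_colour_check:
  "colour4 [False, False, False, False, False, False, False] = False \<and>
   colour4 [False, False, False, False, False, False, True] = True \<and>
   colour4 [True, False, False, False, False, False, False] = True \<and>
   colour4 [True, False, False, False, False, False, True] = False"
  by code_simp

lemma CIST_partition_4: "CIST_partition (dual_cube 4) colour4 partner4"
proof -
  let ?R = "{(a, b) \<in> parcs (dual_cube 4). colour4 a = colour4 b}"
  have to_root: "(u, root4 (colour4 u)) \<in> ?R\<^sup>*" if "length u = 7" for u
    using that
  proof (induction "entry depths u" arbitrary: u rule: less_induct)
    case less
    show ?case
    proof (cases "u = root4 (colour4 u)")
      case False
      then have "free_position 4 u (entry parent_positions u)"
        and same: "colour4 (parent4 u) = colour4 u"
        and "entry depths (parent4 u) < entry depths u"
        using n_lists_check[OF parent_check less.prems] by auto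
      then have "(u, parent4 u) \<in> ?R" "(parent4 u, root4 (colour4 u)) \<in> ?R\<^sup>*"
        using less.prems less.hyps[of "parent4 u"]
        by (auto simp: dual_cube_arc_iff parent4_def)
      then show ?thesis by (rule converse_rtrancl_into_rtrancl)
    qed auto
  qed
  have "sym ?R"
    using pair_graph_symD[OF pair_graph_dual_cube] by (auto simp: sym_def)
  then have "sym (?R\<^sup>*)" by (rule sym_rtrancl)
  then have "(u, v) \<in> ?R\<^sup>*" if "length u = 7" "length v = 7" "colour4 u = colour4 v" for u v
    using to_root[OF that(1)] symD[OF \<open>sym (?R\<^sup>*)\<close> to_root[OF that(2)]]
    by (simp add: that(3) rtrancl_trans)
  moreover have "(u, partner4 u) \<in> parcs (dual_cube 4) \<and> colour4 (partner4 u) \<noteq> colour4 u \<and>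
      partner4 (partner4 u) \<noteq> u" if "length u = 7" for u
    using n_lists_check[OF partner_check that] that
    by (auto simp: dual_cube_arc_iff partner4_def)
  ultimately show ?thesis
    by (simp add: CIST_partition_def pverts_dual_cube)
qed

lemma meets_both_classes_4: "meets_both_classes 4 colour4"
  unfolding meets_both_classes_def
proof (intro allI)
  fix b t
  show "\<exists>u. length u = 2*4-1 \<and> colour4 u = b \<and> bit_at u (2*4-1) = t"
    using class_colour_check
    by (intro exI[of _ "[t, False, False, False, False, False, b \<noteq> t]"])
      (cases b; cases t; simp add: bit_at_def)
qed

lemma CIST_partition_dual_cube:
  assumes "n \<ge> 4"
  shows "\<exists>c f. CIST_partition (dual_cube n) c f \<and> meets_both_classes n c"
  using assms
proof (induction n rule: nat_induct_at_least)
  case base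
  then show ?case using CIST_partition_4 meets_both_classes_4 by blast
next
  case (Suc n)
  then show ?case using CIST_partition_extends[of n] by fastforce
qed

theorem theorem3:
  shows "admits_two_CISTs (dual_cube 4) \<and>
    (\<forall>n::nat. n \<ge> 1 \<longrightarrow> (admits_two_CISTs (dual_cube n) \<longleftrightarrow> n \<ge> 4))"
proof -
  have "admits_two_CISTs (dual_cube n)" if n: "n \<ge> 4" for n
  proof -
    obtain c f where "CIST_partition (dual_cube n) c f"
      using CIST_partition_dual_cube[OF n] by blast
    moreover have "pverts (dual_cube n) \<noteq> {}"
      unfolding pverts_dual_cube using Ex_list_of_length[of "2*n-1"] by auto
    ultimately show ?thesis
      using CIST_partition_imp_two_CISTs[OF pair_graph_dual_cube] by blast
  qed
  then show ?thesis using two_CISTs_imp_ge_4 by auto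
qed

end
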